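(* Let $n$ be even. Every $(n-2)$-regular graph on $n$ vertices has an internal bisection.
   Context: Graphs are finite and simple. For $S\subseteq V$, $d_S(v)$ is the number of neighbors of $v$ in $S$ and $d(v)$ the degree of $v$. An internal partition is a partition $V=A\dot\cup B$ with $A,B\ne\emptyset$ such that $d_A(x)\ge d(x)/2$ for all $x\in A$ and $d_B(x)\ge d(x)/2$ for all $x\in B$. An internal bisection is an internal partition with $|A|=|B|$. *)

theory Defs
  imports Complex_Main "Graph_Theory.Pair_Digraph"
begin

text \<open>
  Finite simple graphs are the finite, symmetric, loop-free digraphs without parallel arcs of the
  locale \<open>pair_graph\<close>: an edge \<open>uv\<close> is the pair of arcs \<open>(u, v)\<close> and \<open>(v, u)\<close>. The degree of a
  vertex is therefore its out-degree.
\<close>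

abbreviation degree :: "'a pair_pre_digraph \<Rightarrow> 'a \<Rightarrow> nat" where
  "degree G v \<equiv> out_degree (with_proj G) v"

definition degree_in :: "'a pair_pre_digraph \<Rightarrow> 'a set \<Rightarrow> 'a \<Rightarrow> nat" where
  "degree_in G S v = card {u \<in> S. (v, u) \<in> parcs G}"

definition regular_graph :: "nat \<Rightarrow> 'a pair_pre_digraph \<Rightarrow> bool" where
  "regular_graph d G \<longleftrightarrow> pair_graph G \<and> (\<forall>v \<in> pverts G. degree G v = d)"

definition internal_partition :: "'a pair_pre_digraph \<Rightarrow> 'a set \<Rightarrow> 'a set \<Rightarrow> bool" where
  "internal_partition G A B \<longleftrightarrow>
     A \<union> B = pverts G \<and> A \<inter> B = {} \<and> A \<noteq> {} \<and> B \<noteq> {} \<and>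
     (\<forall>x \<in> A. real (degree_in G A x) \<ge> real (degree G x) / 2) \<and>
     (\<forall>x \<in> B. real (degree_in G B x) \<ge> real (degree G x) / 2)"

definition internal_bisection :: "'a pair_pre_digraph \<Rightarrow> 'a set \<Rightarrow> 'a set \<Rightarrow> bool" where
  "internal_bisection G A B \<longleftrightarrow> internal_partition G A B \<and> card A = card B"

lemma degree_eq_degree_in:
  assumes "pair_graph G"
  shows "degree G v = degree_in G (pverts G) v"
proof -
  interpret pair_graph G by (fact assms)
  have "out_arcs (with_proj G) v = Pair v ` {u \<in> pverts G. (v, u) \<in> parcs G}"
    by (auto simp: out_arcs_def dest: in_arcsD2)
  then show ?thesis
    by (simp add: out_degree_def degree_in_def card_image inj_on_def)
qed

end

theory Submission
  imports Defs
begin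

text \<open>
  The non-neighbours in an \<open>(n - 2)\<close>-regular graph form a perfect matching, i.e. a fixed-point-free
  involution \<open>m\<close> of the vertices. If \<open>A\<close> contains exactly one vertex of each matched pair, then
  \<open>A\<close> and its complement are cliques with \<open>n / 2\<close> vertices, so every vertex has
  \<open>n / 2 - 1 = (n - 2) / 2\<close> neighbours on its own side.
\<close>

text \<open>Number the vertices injectively by naturals and take from each pair
  \<open>{v, m v}\<close> the one with the smaller number. Since \<open>m v \<noteq> v\<close>, the
  two numbers differ, so exactly one of the pair is taken.\<close>

lemma involution_transversal:
  assumes "finite V"
    and m: "\<And>v. v \<in> V \<Longrightarrow> m v \<in> V" "\<And>v. v \<in> V \<Longrightarrow> m v \<noteq> v" "\<And>v. v \<in> V \<Longrightarrow> m (m v) = v"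
  obtains A where "A \<subseteq> V" "m ` A = V - A"
proof -
  obtain f :: "'a \<Rightarrow> nat" where f: "inj_on f V"
    using finite_imp_inj_to_nat_seg[OF \<open>finite V\<close>] by blast
  let ?A = "{v \<in> V. f v < f (m v)}"
  have "m ` ?A = V - ?A"
  proof
    show "m ` ?A \<subseteq> V - ?A"
      using m by auto
    show "V - ?A \<subseteq> m ` ?A"
    proof
      fix v assume v: "v \<in> V - ?A"
      then have "f (m v) \<noteq> f v"
        using f m by (auto dest: inj_onD)
      with v m have "m v \<in> ?A" by auto
      with v m show "v \<in> m ` ?A" by (metis DiffD1 imageI)
    qed
  qed
  then show thesis by (intro that[of ?A]) auto
qed

lemma clique_degree_in:
  assumes "finite S" "x \<in> S" "\<And>u. u \<in> S \<Longrightarrow> (x, u) \<in> parcs G \<longleftrightarrow> u \<noteq> x"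
  shows "degree_in G S x = card S - 1"
proof -
  have "{u \<in> S. (x, u) \<in> parcs G} = S - {x}"
    using assms(3) by auto
  then show ?thesis
    using assms(1,2) by (simp add: degree_in_def)
qed

theorem theorem2:
  fixes G :: "'a pair_pre_digraph" and n :: nat
  assumes "even n" and "n \<ge> 2"
    and "card (pverts G) = n"
    and "regular_graph (n - 2) G"
  shows "\<exists>A B. internal_bisection G A B"
proof -
  interpret pair_graph G
    using assms(4) by (simp add: regular_graph_def)
  let ?V = "pverts G"
  have deg: "degree G v = n - 2" if "v \<in> ?V" for v
    using assms(4) that by (simp add: regular_graph_def)
  have sym: "(u, v) \<in> parcs G \<longleftrightarrow> (v, u) \<in> parcs G" for u v
    using arcs_symmetric by blast
  have irrefl: "(v, v) \<notin> parcs G" for v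
    using no_loops' by blast
  \<comment> \<open>Removing the \<open>n - 2\<close> neighbours of \<open>v\<close> from the
    \<open>n - 1\<close> other vertices leaves exactly one; \<open>n \<ge> 2\<close> keeps the
    truncated subtractions exact.\<close>
  have "\<exists>u. {w \<in> ?V - {v}. (v, w) \<notin> parcs G} = {u}" if "v \<in> ?V" for v
  proof -
    let ?N = "{w \<in> ?V. (v, w) \<in> parcs G}"
    have N: "card ?N = n - 2"
      using deg[OF that] degree_eq_degree_in[OF pair_graph_axioms, of v]
      by (simp add: degree_in_def)
    have "{w \<in> ?V - {v}. (v, w) \<notin> parcs G} = ?V - {v} - ?N" by auto
    moreover have "card (?V - {v} - ?N) = card (?V - {v}) - card ?N"
      using irrefl by (intro card_Diff_subset) auto
    moreover have "card (?V - {v}) = n - 1"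
      using that assms(3) by simp
    ultimately have "card {w \<in> ?V - {v}. (v, w) \<notin> parcs G} = 1"
      using N assms(2) by simp
    then show ?thesis by (simp add: card_1_singleton_iff)
  qed
  then obtain m where m: "\<And>v. v \<in> ?V \<Longrightarrow> {w \<in> ?V - {v}. (v, w) \<notin> parcs G} = {m v}"
    by metis
  have m_iff: "w = m v \<longleftrightarrow> w \<noteq> v \<and> (v, w) \<notin> parcs G" if "v \<in> ?V" "w \<in> ?V" for v w
    using m[OF that(1)] that(2) by blast
  have mV: "m v \<in> ?V" if "v \<in> ?V" for v
    using m[OF that] by blast
  have m_neq: "m v \<noteq> v" if "v \<in> ?V" for v
    using m_iff that mV by metis
  \<comment> \<open>By symmetry \<open>v\<close> is a non-neighbour of \<open>m v\<close>, and
    \<open>m v\<close> has only one besides itself.\<close>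
  have mm: "m (m v) = v" if "v \<in> ?V" for v
    using m_iff that mV sym by metis
  obtain A where A: "A \<subseteq> ?V" "m ` A = ?V - A"
    using involution_transversal[of ?V m] mV m_neq mm by auto
  let ?B = "?V - A"
  have fin: "finite A" "finite ?B"
    using finite_subset[OF A(1)] by auto
  have "inj_on m A"
    using A(1) mm by (metis inj_on_def subsetD)
  then have cards: "card A = card ?B"
    using A(2) card_image by metis
  have n: "n = card A + card ?B"
    using A(1) assms(3) fin(1) card_Diff_subset card_mono[OF finite_verts] by fastforce
  have mA: "m x \<notin> A" if "x \<in> A" for x
    using A(2) that by blast
  \<comment> \<open>Such an \<open>x\<close> is \<open>m a\<close> for some \<open>a\<close> in
    \<open>A\<close>, and the involution sends it back to \<open>a\<close>.\<close>
  have mB: "m x \<notin> ?B" if "x \<in> ?B" for x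
    using A that mm by (metis DiffE imageE subsetD)
  \<comment> \<open>Stated for a general \<open>S\<close> so that it serves both sides. The only
    non-neighbour of \<open>x\<close> besides itself is \<open>m x\<close>, which lies outside
    \<open>S\<close>; the bound is then attained with equality.\<close>
  have clique: "real (degree_in G S x) \<ge> real (degree G x) / 2"
    if S: "S \<subseteq> ?V" "finite S" "n = 2 * card S" "\<And>x. x \<in> S \<Longrightarrow> m x \<notin> S" "x \<in> S" for S x
  proof -
    have "(x, u) \<in> parcs G \<longleftrightarrow> u \<noteq> x" if "u \<in> S" for u
      using m_iff[of x u] S that irrefl by blast
    then have "degree_in G S x = card S - 1"
      using clique_degree_in S(2,5) by metis
    moreover have "degree G x = 2 * (card S - 1)"
      using deg S by auto
    ultimately show ?thesis by simp
  qed
  \<comment> \<open>The sides have equal size, so if one were empty both would be, giving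
    \<open>n = 0\<close>.\<close>
  have "A \<noteq> {}" "?B \<noteq> {}"
    using n cards assms(2) by (metis add_0 card.empty not_numeral_le_zero)+
  moreover have "real (degree_in G A x) \<ge> real (degree G x) / 2" if "x \<in> A" for x
    using clique[OF A(1) fin(1)] n cards mA that by simp
  moreover have "real (degree_in G ?B x) \<ge> real (degree G x) / 2" if "x \<in> ?B" for x
    using clique[OF Diff_subset fin(2)] n cards mB that by simp
  ultimately have "internal_partition G A ?B"
    using A(1) by (auto simp: internal_partition_def)
  then show ?thesis
    using cards by (auto simp: internal_bisection_def)
qed

end
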